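(* Let $\mathbb{F}$ be a field, let $(S_1,m_1),\dots,(S_n,m_n)$ be nonempty finite multisets of elements of $\mathbb{F}$ of sizes $d_i=d(S_i)$, and for each $i$ let $(D_i,m_i)$ be a nonempty tight multisubset of $(S_i,m_i)$. Put $S=S_1\times\cdots\times S_n$, $D=D_1\times\cdots\times D_n$, $$g_i(x_i)=\prod_{s\in S_i}(x_i-s)^{m_i(s)},\qquad \ell_i(x_i)=\prod_{s\in D_i}(x_i-s)^{m_i(s)}\qquad (i=1,\dots,n).$$ Let $f\in\mathbb{F}[x_1,\dots,x_n]$ be a polynomial such that $f\in I(\mathbf{s},m(\mathbf{s}))$ for all $\mathbf{s}\in S\setminus D$, and there is at least one $\mathbf{s}^*\in D$ for which $f\notin I(\mathbf{s}^*,m(\mathbf{s}^* ))$. Then there are polynomials $h_1,\dots,h_n,r\in\mathbb{F}[x_1,\dots,x_n]$ such that $\deg h_i\le\deg f-d_i$ for every $i$, the degree of $r$ in $x_i$ is less than $d_i$ for every $i$, $$f(\mathbf{x})=r(\mathbf{x})+\sum_{i=1}^n h_i(\mathbf{x})g_i(x_i),$$ and $$r=h\prod_{i=1}^n\frac{g_i(x_i)}{\ell_i(x_i)}$$ for some nonzero $h\in\mathbb{F}[x_1,\dots,x_n]$. As a consequence, $\deg f\ge\sum_{i=1}^n\big(d(S_i)-d(D_i)\big)$.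
   Context: A finite multiset $(S_i,m_i)$ of elements of $\mathbb{F}$ is a finite subset $S_i\subseteq\mathbb{F}$ together with a positive integer multiplicity $m_i(s)$ for each $s\in S_i$; it is nonempty if $S_i\neq\emptyset$. Its size is $d(S_i)=\sum_{s\in S_i}m_i(s)$. A tight multisubset $(D_i,m_i)$ of $(S_i,m_i)$ is a subset $D_i\subseteq S_i$ with every element of $D_i$ having the same multiplicity as in $(S_i,m_i)$; so $d(D_i)=\sum_{s\in D_i}m_i(s)$. For $\mathbf{s}=(s_1,\dots,s_n)\in S$ put $m(\mathbf{s})=(m_1(s_1),\dots,m_n(s_n))$. $\mathbb{N}$ is the set of nonnegative integers. For $\mathbf{s}\in\mathbb{F}^n$ and $\mathbf{u}\in\mathbb{N}^n$, $(\mathbf{x}-\mathbf{s})^{\mathbf{u}}=\prod_{i=1}^n(x_i-s_i)^{u_i}$. Every $f\in\mathbb{F}[x_1,\dots,x_n]$ has a unique expansion $f(\mathbf{x})=\sum_{\mathbf{u}\in\mathbb{N}^n}f_{\mathbf{u}}(\mathbf{s})(\mathbf{x}-\mathbf{s})^{\mathbf{u}}$ with $f_{\mathbf{u}}(\mathbf{s})\in\mathbb{F}$. For a vector $\mathbf{w}$ of positive integers, $I(\mathbf{s},\mathbf{w})$ is the ideal of all $f$ with $f_{\mathbf{u}}(\mathbf{s})=0$ for all $\mathbf{u}<\mathbf{w}$, where $\mathbf{u}<\mathbf{w}$ means $u_i<w_i$ for every $i$. $\deg$ denotes total degree; the zero polynomial is regarded as having degree $-\infty$ (so $h_i=0$ if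 $\deg f<d_i$). *)

theory Defs
  imports
    "HOL-Computational_Algebra.Polynomial"
    "HOL-Library.Poly_Mapping"
    "HOL-Library.Extended_Real"
    "HOL-Library.Multiset"
    "HOL-Library.FuncSet"
begin

text \<open>
  The polynomial ring in finitely many variables, indexed by the finite type \<open>'n\<close>, over \<open>'a\<close>:
  finitely supported maps from exponent vectors to coefficients, with the convolution product.
\<close>

type_synonym ('n, 'a) mpol = "('n \<Rightarrow>\<^sub>0 nat) \<Rightarrow>\<^sub>0 'a"

definition mconst :: "'a::field \<Rightarrow> ('n::finite, 'a) mpol" where
  "mconst a = Poly_Mapping.single 0 a"

definition mvar :: "'n::finite \<Rightarrow> ('n, 'a::field) mpol" where
  "mvar i = Poly_Mapping.single (Poly_Mapping.single i 1) 1"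

text \<open>
  Both degrees take the value \<open>-\<infinity>\<close> at the zero polynomial, because the supremum of the
  empty set of extended reals is \<open>-\<infinity>\<close>.
\<close>

definition mtotal_degree :: "('n::finite, 'a::field) mpol \<Rightarrow> ereal" where
  "mtotal_degree f =
     (SUP u\<in>Poly_Mapping.keys f. ereal (real (\<Sum>i\<in>UNIV. Poly_Mapping.lookup u i)))"

definition mdegree_in :: "'n::finite \<Rightarrow> ('n, 'a::field) mpol \<Rightarrow> ereal" where
  "mdegree_in i f = (SUP u\<in>Poly_Mapping.keys f. ereal (real (Poly_Mapping.lookup u i)))"

definition at_var :: "'n::finite \<Rightarrow> 'a::field poly \<Rightarrow> ('n, 'a) mpol" where
  "at_var i p = poly (map_poly mconst p) (mvar i)"

definition mset_poly :: "'a::field multiset \<Rightarrow> 'a poly" where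
  "mset_poly M = (\<Prod>s\<in>set_mset M. [:- s, 1:] ^ count M s)"

text \<open>
  The condition is stronger than \<^term>\<open>D \<subseteq># S\<close>: elements of \<^term>\<open>D\<close> keep their full
  multiplicity in \<^term>\<open>S\<close>.
\<close>

definition tight_submultiset :: "'a multiset \<Rightarrow> 'a multiset \<Rightarrow> bool" where
  "tight_submultiset D S \<longleftrightarrow>
     set_mset D \<subseteq> set_mset S \<and> (\<forall>s\<in>set_mset D. count D s = count S s)"

definition mset_grid :: "('n \<Rightarrow> 'a multiset) \<Rightarrow> ('n \<Rightarrow> 'a) set" where
  "mset_grid S = (\<Pi> i\<in>UNIV. set_mset (S i))"

definition shifted_monom :: "('n::finite \<Rightarrow> 'a::field) \<Rightarrow> ('n \<Rightarrow>\<^sub>0 nat) \<Rightarrow> ('n, 'a) mpol" where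
  "shifted_monom s u = (\<Prod>i\<in>UNIV. (mvar i - mconst (s i)) ^ Poly_Mapping.lookup u i)"

definition shifted_expansion :: "('n::finite \<Rightarrow> 'a::field) \<Rightarrow> ('n, 'a) mpol \<Rightarrow> ('n, 'a) mpol" where
  "shifted_expansion s c =
     (\<Sum>u\<in>Poly_Mapping.keys c. mconst (Poly_Mapping.lookup c u) * shifted_monom s u)"

text \<open>
  The coefficient \<open>f\<^sub>u(s)\<close>.  The coefficient family of the expansion is itself a finitely
  supported function of \<open>u\<close>; its existence and uniqueness is lemma \<open>shifted_expansion_unique\<close>
  below.
\<close>

definition shifted_coeff :: "('n::finite, 'a::field) mpol \<Rightarrow> ('n \<Rightarrow>\<^sub>0 nat) \<Rightarrow> ('n \<Rightarrow> 'a) \<Rightarrow> 'a" where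
  "shifted_coeff f u s = Poly_Mapping.lookup (THE c. f = shifted_expansion s c) u"

definition mult_ideal :: "('n::finite \<Rightarrow> 'a::field) \<Rightarrow> ('n \<Rightarrow> nat) \<Rightarrow> ('n, 'a) mpol set" where
  "mult_ideal s w =
     {f. \<forall>u. (\<forall>i. Poly_Mapping.lookup u i < w i) \<longrightarrow> shifted_coeff f u s = 0}"


subsection \<open>Existence and uniqueness of the shifted expansion\<close>

lemma mconst_simps:
  "mconst 0 = 0" "mconst 1 = 1" "mconst (a + b) = mconst a + mconst b"
  "mconst (a - b) = mconst a - mconst b" "mconst (a * b) = mconst a * mconst b"
  by (simp_all add: mconst_def single_add single_diff mult_single)

lemma shifted_expansion_superset:
  assumes "finite A" "Poly_Mapping.keys c \<subseteq> A"
  shows "shifted_expansion s c =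
    (\<Sum>u\<in>A. mconst (Poly_Mapping.lookup c u) * shifted_monom s u)"
  unfolding shifted_expansion_def
  by (rule sum.mono_neutral_left) (use assms in \<open>auto simp: in_keys_iff mconst_simps\<close>)

lemma shifted_expansion_add:
  "shifted_expansion s (c + d) = shifted_expansion s c + shifted_expansion s d"
proof -
  let ?A = "Poly_Mapping.keys c \<union> Poly_Mapping.keys d"
  have "Poly_Mapping.keys (c + d) \<subseteq> ?A" by (rule Poly_Mapping.keys_add)
  then show ?thesis
    by (simp add: shifted_expansion_superset[of ?A] lookup_add mconst_simps
        distrib_right sum.distrib)
qed

lemma shifted_expansion_diff:
  "shifted_expansion s (c - d) = shifted_expansion s c - shifted_expansion s d"
  using shifted_expansion_add[of s "c - d" d] by simp

lemma shifted_expansion_single: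
  "shifted_expansion s (Poly_Mapping.single u a) = mconst a * shifted_monom s u"
  by (simp add: shifted_expansion_def mconst_simps)

lemma shifted_monom_add:
  "shifted_monom s (u + v) = shifted_monom s u * shifted_monom s v"
  by (simp add: shifted_monom_def lookup_add power_add prod.distrib)

lemma shifted_monom_0 [simp]: "shifted_monom s 0 = 1"
  by (simp add: shifted_monom_def)

lemma shifted_monom_var:
  "shifted_monom s (Poly_Mapping.single i 1) = mvar i - mconst (s i)"
proof -
  have "shifted_monom s (Poly_Mapping.single i 1) =
      (\<Prod>j\<in>UNIV. if j = i then mvar i - mconst (s i) else 1)"
    unfolding shifted_monom_def by (rule prod.cong) (auto simp: lookup_single when_def)
  then show ?thesis by simp
qed

lemma range_shifted_expansion_add:
  "f \<in> range (shifted_expansion s) \<Longrightarrow> g \<in> range (shifted_expansion s) \<Longrightarrow>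
    f + g \<in> range (shifted_expansion s)"
  by (auto simp flip: shifted_expansion_add)

lemma range_shifted_expansion_mvar:
  assumes "f \<in> range (shifted_expansion s)"
  shows "f * mvar i \<in> range (shifted_expansion s)"
proof -
  obtain c where f: "f = shifted_expansion s c" using assms by auto
  have "f * mvar i = (\<Sum>u\<in>Poly_Mapping.keys c.
      mconst (Poly_Mapping.lookup c u) * shifted_monom s u * mvar i)"
    by (simp add: f shifted_expansion_def sum_distrib_right)
  moreover have "mconst a * shifted_monom s u * mvar i \<in> range (shifted_expansion s)" for a u
  proof -
    have "mconst a * shifted_monom s u * mvar i =
        mconst a * shifted_monom s (u + Poly_Mapping.single i 1)
        + mconst (a * s i) * shifted_monom s u"
      by (simp only: shifted_monom_add shifted_monom_var mconst_simps) (simp add: algebra_simps)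
    also have "\<dots> = shifted_expansion s (Poly_Mapping.single (u + Poly_Mapping.single i 1) a
        + Poly_Mapping.single u (a * s i))"
      by (simp only: shifted_expansion_add shifted_expansion_single)
    finally show ?thesis by simp
  qed
  moreover have "0 \<in> range (shifted_expansion s)"
    by (rule range_eqI[of _ _ 0]) (simp add: shifted_expansion_def)
  moreover have "sum g A \<in> range (shifted_expansion s)"
    if "\<And>u. u \<in> A \<Longrightarrow> g u \<in> range (shifted_expansion s)" "0 \<in> range (shifted_expansion s)"
    for g :: "('a \<Rightarrow>\<^sub>0 nat) \<Rightarrow> _" and A
    using that by (induction A rule: infinite_finite_induct)
      (simp_all add: range_shifted_expansion_add)
  ultimately show ?thesis by simp
qed

definition lead_monom :: "('n::finite, 'a::field) mpol \<Rightarrow> ('n \<Rightarrow>\<^sub>0 nat) \<Rightarrow> bool" where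
  "lead_monom f v \<longleftrightarrow> (\<exists>g. f = Poly_Mapping.single v 1 + g \<and>
     (\<forall>w\<in>Poly_Mapping.keys g.
        (\<Sum>i\<in>UNIV. Poly_Mapping.lookup w i) < (\<Sum>i\<in>UNIV. Poly_Mapping.lookup v i)))"

lemma lead_monom_1: "lead_monom 1 0"
  unfolding lead_monom_def by (intro exI[of _ 0]) simp

lemma lead_monom_mult:
  assumes "lead_monom f v" "lead_monom g w"
  shows "lead_monom (f * g) (v + w)"
proof -
  let ?t = "\<lambda>u. \<Sum>i\<in>UNIV. Poly_Mapping.lookup u i"
  obtain f' where f: "f = Poly_Mapping.single v 1 + f'" "\<forall>u\<in>Poly_Mapping.keys f'. ?t u < ?t v"
    using assms(1) unfolding lead_monom_def by blast
  obtain g' where g: "g = Poly_Mapping.single w 1 + g'" "\<forall>u\<in>Poly_Mapping.keys g'. ?t u < ?t w"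
    using assms(2) unfolding lead_monom_def by blast
  let ?h = "Poly_Mapping.single v 1 * g' + f' * Poly_Mapping.single w 1 + f' * g'"
  have eq: "f * g = Poly_Mapping.single (v + w) 1 + ?h"
    by (simp add: f(1) g(1) algebra_simps mult_single)
  have t: "?t (a + b) = ?t a + ?t b" for a b by (simp add: lookup_add sum.distrib)
  have "?t u < ?t (v + w)" if "u \<in> Poly_Mapping.keys ?h" for u
  proof -
    have "u \<in> Poly_Mapping.keys (Poly_Mapping.single v 1 * g')
        \<union> Poly_Mapping.keys (f' * Poly_Mapping.single w 1) \<union> Poly_Mapping.keys (f' * g')"
      by (rule subsetD[OF order_trans[OF Poly_Mapping.keys_add Un_mono[OF Poly_Mapping.keys_add order_refl]] that])
    then consider "u \<in> Poly_Mapping.keys (Poly_Mapping.single v 1 * g')"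
      | "u \<in> Poly_Mapping.keys (f' * Poly_Mapping.single w 1)"
      | "u \<in> Poly_Mapping.keys (f' * g')"
      by blast
    then obtain a b where "u = a + b"
      "a = v \<and> b \<in> Poly_Mapping.keys g' \<or> a \<in> Poly_Mapping.keys f' \<and> b = w
       \<or> a \<in> Poly_Mapping.keys f' \<and> b \<in> Poly_Mapping.keys g'"
    proof cases
      case 1
      from subsetD[OF keys_mult 1] show ?thesis using that by auto
    next
      case 2
      from subsetD[OF keys_mult 2] show ?thesis using that by auto
    next
      case 3
      from subsetD[OF keys_mult 3] show ?thesis using that by auto
    qed
    then show ?thesis unfolding \<open>u = a + b\<close> t using f(2) g(2) by (auto intro: add_strict_mono)
  qed
  with eq show ?thesis unfolding lead_monom_def by blast
qed

lemma lead_monom_shifted: "lead_monom (shifted_monom s u) u"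
proof -
  have lin: "lead_monom (mvar i - mconst a) (Poly_Mapping.single i 1)" for i :: 'a and a :: 'b
  proof -
    have "(\<Sum>j\<in>UNIV. Poly_Mapping.lookup (Poly_Mapping.single i (1::nat)) j) = 1"
      by (simp add: lookup_single when_def)
    then show ?thesis
      unfolding lead_monom_def
      by (intro exI[of _ "- mconst a"]) (auto simp: mvar_def mconst_def split: if_splits)
  qed
  have pow: "lead_monom ((mvar i - mconst a) ^ k) (Poly_Mapping.single i k)"
    for i :: 'a and a :: 'b and k
  proof (induction k)
    case 0
    show ?case by (simp add: lead_monom_1)
  next
    case (Suc k)
    have "Poly_Mapping.single i (Suc k) = Poly_Mapping.single i 1 + Poly_Mapping.single i k"
      by (simp flip: single_add)
    with lead_monom_mult[OF lin Suc, of i a] show ?case by (simp only: power_Suc)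
  qed
  have "lead_monom (\<Prod>i\<in>A. (mvar i - mconst (s i)) ^ Poly_Mapping.lookup u i)
      (\<Sum>i\<in>A. Poly_Mapping.single i (Poly_Mapping.lookup u i))" for A
    by (induction A rule: infinite_finite_induct) (auto simp: lead_monom_1 intro: lead_monom_mult pow)
  from this[of UNIV] have "lead_monom (shifted_monom s u)
      (\<Sum>i\<in>UNIV. Poly_Mapping.single i (Poly_Mapping.lookup u i))"
    unfolding shifted_monom_def .
  moreover have "(\<Sum>i\<in>UNIV. Poly_Mapping.single i (Poly_Mapping.lookup u i)) = u"
    by (rule poly_mapping_eqI) (simp add: lookup_sum lookup_single when_def)
  ultimately show ?thesis by simp
qed

lemma shifted_expansion_eq_0:
  assumes "shifted_expansion s c = 0"
  shows "c = 0"
proof (rule ccontr)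
  let ?t = "\<lambda>u. \<Sum>i\<in>UNIV. Poly_Mapping.lookup u i"
  let ?K = "Poly_Mapping.keys c"
  assume "c \<noteq> 0"
  then have "?K \<noteq> {}" by simp
  then have "Max (?t ` ?K) \<in> ?t ` ?K" by (intro Max_in) auto
  then obtain u where u: "u \<in> ?K" "?t u = Max (?t ` ?K)" by auto
  have le: "?t v \<le> ?t u" if "v \<in> ?K" for v using that u(2) by simp
  have coeff: "Poly_Mapping.lookup (shifted_monom s v) u = (if v = u then 1 else 0)"
    if "v \<in> ?K" for v
  proof -
    obtain g where g: "shifted_monom s v = Poly_Mapping.single v 1 + g"
      "\<forall>w\<in>Poly_Mapping.keys g. ?t w < ?t v"
      using lead_monom_shifted[of s v] unfolding lead_monom_def by blast
    have "u \<notin> Poly_Mapping.keys g" using g(2) le[OF that] by (meson leD)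
    then show ?thesis by (simp add: g(1) lookup_add lookup_single in_keys_iff when_def)
  qed
  have scale: "Poly_Mapping.lookup (mconst a * p) u = a * Poly_Mapping.lookup p u"
    for a and p :: "('a, 'b) mpol"
    unfolding mconst_def mult_map_scale_conv_mult[symmetric]
    by (simp add: Poly_Mapping.map.rep_eq when_def)
  have "Poly_Mapping.lookup (shifted_expansion s c) u
      = (\<Sum>v\<in>?K. Poly_Mapping.lookup c v * (if v = u then 1 else 0))"
    by (simp add: shifted_expansion_def lookup_sum scale coeff cong: sum.cong)
  also have "\<dots> = Poly_Mapping.lookup c u" using u(1) by (simp add: if_distrib cong: if_cong)
  finally show False using u(1) assms by (simp add: in_keys_iff)
qed

lemma shifted_expansion_surj: "f \<in> range (shifted_expansion s)"
proof -
  let ?R = "range (shifted_expansion s)"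
  have cst: "mconst a \<in> ?R" for a
    by (rule range_eqI[of _ _ "Poly_Mapping.single 0 a"]) (simp add: shifted_expansion_single)
  have pow: "g * mvar i ^ k \<in> ?R" if "g \<in> ?R" for g i k
  proof (induction k)
    case 0
    show ?case using that by simp
  next
    case (Suc k)
    have "g * mvar i ^ Suc k = g * mvar i ^ k * mvar i" by (simp only: power_Suc2 mult.assoc)
    then show ?case using range_shifted_expansion_mvar[OF Suc, of i] by (simp only:)
  qed
  have prod: "mconst a * (\<Prod>i\<in>A. mvar i ^ Poly_Mapping.lookup u i) \<in> ?R" for a u and A :: "'a set"
  proof (induction A rule: infinite_finite_induct)
    case (insert i A)
    have "mconst a * (\<Prod>j\<in>insert i A. mvar j ^ Poly_Mapping.lookup u j)
        = mconst a * (\<Prod>j\<in>A. mvar j ^ Poly_Mapping.lookup u j) * mvar i ^ Poly_Mapping.lookup u i"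
      using insert.hyps by (simp add: mult.assoc mult.commute[of "mvar i ^ _"])
    then show ?case using pow[OF insert.IH] by simp
  qed (simp_all add: cst)
  have var: "mvar i ^ k = (Poly_Mapping.single (Poly_Mapping.single i k) 1 :: ('a, 'b) mpol)" for i k
    by (induction k) (simp_all add: mvar_def mult_single flip: single_add)
  have mon: "(\<Prod>i\<in>A. mvar i ^ Poly_Mapping.lookup u i) = (Poly_Mapping.single
      (\<Sum>i\<in>A. Poly_Mapping.single i (Poly_Mapping.lookup u i)) 1 :: ('a, 'b) mpol)" for u A
    by (induction A rule: infinite_finite_induct) (simp_all add: var mult_single)
  have "(\<Sum>i\<in>UNIV. Poly_Mapping.single i (Poly_Mapping.lookup u i)) = u" for u :: "'a \<Rightarrow>\<^sub>0 nat"
    by (rule poly_mapping_eqI) (simp add: lookup_sum lookup_single when_def)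
  with prod[of _ _ UNIV] have single: "Poly_Mapping.single u a \<in> ?R" for u a
    by (simp add: mon mconst_def mult_single)
  show ?thesis
  proof (induction f rule: update_induct)
    case const
    show ?case using cst[of 0] by (simp only: mconst_simps)
  next
    case (update g u b)
    have "Poly_Mapping.update u b g = g + Poly_Mapping.single u b"
      using update.hyps(1)
      by (intro poly_mapping_eqI) (auto simp: lookup_update lookup_add lookup_single in_keys_iff when_def)
    with update single show ?case by (simp add: range_shifted_expansion_add)
  qed
qed

lemma shifted_expansion_unique: "\<exists>!c. f = shifted_expansion s c"
proof -
  obtain c where c: "f = shifted_expansion s c" using shifted_expansion_surj by blast
  moreover have "d = c" if "f = shifted_expansion s d" for d
    using shifted_expansion_eq_0[of s "d - c"] that c by (simp add: shifted_expansion_diff)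
  ultimately show ?thesis by blast
qed

end

theory Submission
  imports Defs
begin

text \<open>
  Division by a polynomial in the single variable \<open>x\<^sub>i\<close> with known roots reduces to dividing by
  one linear factor \<open>x\<^sub>i - a\<close> at a time, and so does everything else.

  A linear division \<open>f = (x\<^sub>i - a) q + c\<close>, with \<open>c\<close> free of \<open>x\<^sub>i\<close>, never enlarges an
  exponent: each exponent vector of \<open>x\<^sub>i q\<close> and of \<open>c\<close> is componentwise below one of \<open>f\<close>.  This
  control (\<open>fits_under\<close>) governs the total degree and all partial degrees together, and it
  composes.  Iterating over the roots of \<open>g\<^sub>i\<close>, then over \<open>i\<close>, produces \<open>f = r + \<Sum>h\<^sub>i g\<^sub>i\<close> with
  all the degree bounds (\<open>grid_division\<close>).

  At a grid point \<open>s\<close> the polynomial \<open>g\<^sub>i\<close> is a multiple of \<open>(x\<^sub>i - s\<^sub>i)\<close> to the power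
  \<open>m\<^sub>i(s\<^sub>i)\<close>, so \<open>f\<close> and \<open>r\<close> lie in the same ideals \<open>I(s, m(s))\<close>.  Hence \<open>r\<close> is nonzero and
  still vanishes to the prescribed order on \<open>S - D\<close>.

  For the divisibility of \<open>r\<close>, take a root \<open>a\<close> in \<open>S\<^sub>i - D\<^sub>i\<close> and write \<open>r = (x\<^sub>i - a) q + c\<close>.
  The remainder \<open>c\<close> vanishes on the slice \<open>x\<^sub>i = a\<close> of the grid, to the full order in the other
  variables.  Its partial degrees are below the side lengths of that slice, so uniqueness of
  Hermite interpolation on grids (\<open>unisolvent_grid\<close>) forces \<open>c = 0\<close>.  The quotient \<open>q\<close> satisfies
  the same hypotheses after one copy of \<open>a\<close> is removed from \<open>S\<^sub>i\<close>: cancelling \<open>x\<^sub>i - a\<close> costs one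
  order of vanishing in direction \<open>i\<close> where \<open>s\<^sub>i = a\<close>, and nothing elsewhere, since \<open>x\<^sub>i - a\<close> is a
  unit modulo \<open>I(s, m(s))\<close> there.  Repeating this exhausts \<open>S\<^sub>i - D\<^sub>i\<close> for every \<open>i\<close>
  (\<open>punctured_grid_divisibility\<close>).  Uniqueness of Hermite interpolation itself follows from the
  same peeling step.

  Each peeled factor is one more factor \<open>x\<^sub>i\<close> by which the exponents of the quotient can be
  multiplied while staying below exponents of \<open>f\<close>.  The cofactor left at the end is nonzero, so any
  of its exponents gives the lower bound on \<open>deg f\<close>.
\<close>

section \<open>Exponents and supports\<close>

abbreviation linear_factor :: "'n::finite \<Rightarrow> 'a::field \<Rightarrow> ('n, 'a) mpol" where
  "linear_factor i a \<equiv> mvar i - mconst a"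

abbreviation unit_exp :: "'n \<Rightarrow> 'n \<Rightarrow> nat" where
  "unit_exp i \<equiv> (\<lambda>_. 0)(i := 1)"

text \<open>
  Every exponent of \<open>x\<^sup>v q\<close> divides some exponent of \<open>f\<close>.  Unlike a bound on a degree, this single
  relation is inherited by all monotone notions of degree at once.
\<close>

definition fits_under :: "('n \<Rightarrow> nat) \<Rightarrow> ('n::finite, 'a::field) mpol \<Rightarrow> ('n, 'a) mpol \<Rightarrow> bool" where
  "fits_under v q f \<longleftrightarrow> (\<forall>w\<in>Poly_Mapping.keys q. \<exists>u\<in>Poly_Mapping.keys f.
     \<forall>j. Poly_Mapping.lookup w j + v j \<le> Poly_Mapping.lookup u j)"

lemma fits_underE:
  assumes "fits_under v q f" "w \<in> Poly_Mapping.keys q"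
  obtains u where "u \<in> Poly_Mapping.keys f"
    "\<forall>j. Poly_Mapping.lookup w j + v j \<le> Poly_Mapping.lookup u j"
  using assms unfolding fits_under_def by blast

lemma fits_under_zero [simp]: "fits_under v 0 f"
  by (simp add: fits_under_def)

lemma fits_under_refl [simp]: "fits_under (\<lambda>_. 0) f f"
  by (auto simp: fits_under_def)

lemma fits_under_trans:
  assumes "fits_under v p q" "fits_under w q f"
  shows "fits_under (\<lambda>j. v j + w j) p f"
  unfolding fits_under_def
proof
  fix x assume "x \<in> Poly_Mapping.keys p"
  with assms(1) obtain y where y: "y \<in> Poly_Mapping.keys q"
    "\<And>j. Poly_Mapping.lookup x j + v j \<le> Poly_Mapping.lookup y j" by (rule fits_underE) blast
  from assms(2) y(1) obtain u where u: "u \<in> Poly_Mapping.keys f"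
    "\<And>j. Poly_Mapping.lookup y j + w j \<le> Poly_Mapping.lookup u j" by (rule fits_underE) blast
  have "Poly_Mapping.lookup x j + (v j + w j) \<le> Poly_Mapping.lookup u j" for j
    using y(2)[of j] u(2)[of j] by linarith
  with u(1) show "\<exists>u\<in>Poly_Mapping.keys f.
      \<forall>j. Poly_Mapping.lookup x j + (v j + w j) \<le> Poly_Mapping.lookup u j" by blast
qed

lemma fits_under_trans0:
  assumes "fits_under v p q" "fits_under (\<lambda>_. 0) q f"
  shows "fits_under v p f"
  using fits_under_trans[OF assms] by simp

lemma fits_under_add:
  assumes "fits_under v p f" "fits_under v q f"
  shows "fits_under v (p + q) f"
  using assms Poly_Mapping.keys_add[of p q] unfolding fits_under_def by blast

lemma fits_under_mono:
  assumes "fits_under v p f" "\<And>j. w j \<le> v j"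
  shows "fits_under w p f"
  unfolding fits_under_def
proof
  fix x assume "x \<in> Poly_Mapping.keys p"
  with assms(1) obtain u where u: "u \<in> Poly_Mapping.keys f"
    "\<And>j. Poly_Mapping.lookup x j + v j \<le> Poly_Mapping.lookup u j" by (rule fits_underE) blast
  have "Poly_Mapping.lookup x j + w j \<le> Poly_Mapping.lookup u j" for j
    using u(2)[of j] assms(2)[of j] by linarith
  with u(1) show "\<exists>u\<in>Poly_Mapping.keys f.
      \<forall>j. Poly_Mapping.lookup x j + w j \<le> Poly_Mapping.lookup u j" by blast
qed

lemma mpol_induct [case_names zero add single]:
  fixes f :: "('n::finite, 'a::field) mpol"
  assumes "P 0" "\<And>f g. P f \<Longrightarrow> P g \<Longrightarrow> P (f + g)"
    "\<And>u c. c \<noteq> 0 \<Longrightarrow> P (Poly_Mapping.single u c)"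
  shows "P f"
proof (induction f rule: update_induct)
  case const
  show ?case by (rule assms(1))
next
  case (update g u b)
  have "Poly_Mapping.update u b g = g + Poly_Mapping.single u b"
    using update.hyps(1)
    by (intro poly_mapping_eqI) (auto simp: lookup_update lookup_add lookup_single in_keys_iff when_def)
  with update assms(2,3) show ?case by simp
qed

lemma keys_sum_subset:
  "Poly_Mapping.keys (\<Sum>x\<in>A. F x) \<subseteq> (\<Union>x\<in>A. Poly_Mapping.keys (F x))"
  for F :: "'b \<Rightarrow> ('n::finite, 'a::field) mpol"
proof (induction A rule: infinite_finite_induct)
  case (insert x A)
  then show ?case using Poly_Mapping.keys_add[of "F x" "sum F A"] by auto
qed simp_all

lemma lookup_mconst_mult:
  "Poly_Mapping.lookup (mconst a * p) u = a * Poly_Mapping.lookup p u"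
  unfolding mconst_def mult_map_scale_conv_mult[symmetric]
  by (simp add: Poly_Mapping.map.rep_eq when_def)

lemma keys_mconst_mult: "Poly_Mapping.keys (mconst a * p) \<subseteq> Poly_Mapping.keys p"
  by (auto simp: in_keys_iff lookup_mconst_mult)

lemma lookup_single_mult:
  fixes c :: "('n::finite, 'a::field) mpol"
  shows "Poly_Mapping.lookup (Poly_Mapping.single v 1 * c) (v + u) = Poly_Mapping.lookup c u"
  by (induction c rule: mpol_induct)
    (simp_all add: distrib_left lookup_add mult_single lookup_single when_def)

lemma lookup_single_mult_eq_0:
  fixes c :: "('n::finite, 'a::field) mpol"
  assumes "Poly_Mapping.lookup u i < Poly_Mapping.lookup v i"
  shows "Poly_Mapping.lookup (Poly_Mapping.single v 1 * c) u = 0"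
proof (rule ccontr)
  assume "Poly_Mapping.lookup (Poly_Mapping.single v 1 * c) u \<noteq> 0"
  then have "u \<in> Poly_Mapping.keys (Poly_Mapping.single v 1 * c)" by (simp add: in_keys_iff)
  from subsetD[OF keys_mult this] obtain w where "u = v + w" by auto
  with assms show False by (simp add: lookup_add)
qed

lemma keys_linear_factor_prod:
  fixes M :: "'a::field multiset"
  assumes "w \<in> Poly_Mapping.keys (\<Prod>a\<in>#M. linear_factor i a)"
  shows "Poly_Mapping.lookup w j \<le> (if j = i then size M else 0)"
  using assms
proof (induction M arbitrary: w)
  case empty
  then show ?case by simp
next
  case (add a M)
  from add.prems have "w \<in> Poly_Mapping.keys (linear_factor i a * (\<Prod>a\<in>#M. linear_factor i a))"
    by simp
  from subsetD[OF keys_mult this] obtain x y where w: "w = x + y"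
    and x: "x \<in> Poly_Mapping.keys (linear_factor i a)"
    and y: "y \<in> Poly_Mapping.keys (\<Prod>a\<in>#M. linear_factor i a)" by blast
  from x have "x = Poly_Mapping.single i 1 \<or> x = 0"
    using subsetD[OF keys_diff[of "mvar i" "mconst a"] x]
    by (auto simp: mvar_def mconst_def split: if_splits)
  then have "Poly_Mapping.lookup x j \<le> (if j = i then 1 else 0)"
    by (auto simp: lookup_single when_def)
  with add.IH[OF y] show ?case by (auto simp: w lookup_add split: if_splits)
qed


section \<open>Division with remainder\<close>

text \<open>
  The recursion is \<open>x\<^sub>i x\<^sup>v = (x\<^sub>i - a) x\<^sup>v + a x\<^sup>v\<close>, followed by the division of \<open>x\<^sup>v\<close>.
\<close>

lemma monomial_linear_division:
  fixes u :: "'n::finite \<Rightarrow>\<^sub>0 nat" and a c :: "'a::field"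
  assumes "c \<noteq> 0"
  shows "\<exists>q r. Poly_Mapping.single u c = linear_factor i a * q + r \<and>
    fits_under (unit_exp i) q (Poly_Mapping.single u c) \<and>
    fits_under (\<lambda>_. 0) r (Poly_Mapping.single u c) \<and>
    (\<forall>w\<in>Poly_Mapping.keys r. Poly_Mapping.lookup w i = 0)"
proof (induction "Poly_Mapping.lookup u i" arbitrary: u)
  case 0
  then show ?case by (intro exI[of _ 0] exI[of _ "Poly_Mapping.single u c"]) simp
next
  case (Suc k)
  let ?e = "Poly_Mapping.single i (1::nat)"
  define v where "v = u - ?e"
  have u: "u = v + ?e"
    using Suc.hyps(2) by (intro poly_mapping_eqI)
      (auto simp: v_def lookup_add lookup_minus lookup_single when_def)
  have "k = Poly_Mapping.lookup v i" using Suc.hyps(2) by (simp add: u lookup_add)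
  from Suc.hyps(1)[OF this] obtain q r where
    eq: "Poly_Mapping.single v c = linear_factor i a * q + r"
    and q: "fits_under (unit_exp i) q (Poly_Mapping.single v c)"
    and r: "fits_under (\<lambda>_. 0) r (Poly_Mapping.single v c)"
    and ri: "\<forall>w\<in>Poly_Mapping.keys r. Poly_Mapping.lookup w i = 0" by blast
  have vu: "fits_under (unit_exp i) (Poly_Mapping.single v c) (Poly_Mapping.single u c)"
    using assms by (auto simp: fits_under_def u lookup_add lookup_single when_def)
  then have vu0: "fits_under (\<lambda>_. 0) (Poly_Mapping.single v c) (Poly_Mapping.single u c)"
    by (rule fits_under_mono) simp
  have sub: "fits_under (\<lambda>_. 0) (mconst a * p) p" for p :: "('n, 'a) mpol"
    unfolding fits_under_def using keys_mconst_mult[of a p] by auto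
  have "Poly_Mapping.single u c = mvar i * Poly_Mapping.single v c"
    by (simp add: u mvar_def mult_single add.commute)
  also have "\<dots> = linear_factor i a * Poly_Mapping.single v c + mconst a * Poly_Mapping.single v c"
    by (simp add: algebra_simps)
  also have "mconst a * Poly_Mapping.single v c = mconst a * (linear_factor i a * q + r)"
    by (simp only: eq)
  finally have "Poly_Mapping.single u c =
      linear_factor i a * (Poly_Mapping.single v c + mconst a * q) + mconst a * r"
    by (simp add: algebra_simps)
  moreover have "fits_under (unit_exp i) (Poly_Mapping.single v c + mconst a * q)
      (Poly_Mapping.single u c)"
    using fits_under_trans[OF sub fits_under_trans0[OF q vu0]]
    by (intro fits_under_add vu) (simp add: fun_upd_def)
  moreover have "fits_under (\<lambda>_. 0) (mconst a * r) (Poly_Mapping.single u c)"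
    by (rule fits_under_trans0[OF fits_under_trans0[OF sub r] vu0])
  moreover have "\<forall>w\<in>Poly_Mapping.keys (mconst a * r). Poly_Mapping.lookup w i = 0"
    using ri keys_mconst_mult[of a r] by blast
  ultimately show ?case by blast
qed

text \<open>
  Dividing each monomial of \<open>f\<close> separately is what keeps the exponents under control: an induction
  on \<open>f\<close> itself could lose track of monomials that cancel.
\<close>

lemma linear_division:
  fixes f :: "('n::finite, 'a::field) mpol"
  obtains q r where "f = linear_factor i a * q + r"
    "fits_under (unit_exp i) q f" "fits_under (\<lambda>_. 0) r f"
    "\<And>w. w \<in> Poly_Mapping.keys r \<Longrightarrow> Poly_Mapping.lookup w i = 0"
proof -
  let ?K = "Poly_Mapping.keys f"
  let ?m = "\<lambda>u. Poly_Mapping.single u (Poly_Mapping.lookup f u)"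
  have "\<exists>q r. ?m u = linear_factor i a * q + r \<and> fits_under (unit_exp i) q (?m u) \<and>
      fits_under (\<lambda>_. 0) r (?m u) \<and> (\<forall>w\<in>Poly_Mapping.keys r. Poly_Mapping.lookup w i = 0)"
    if "u \<in> ?K" for u
    using that by (intro monomial_linear_division) (simp add: in_keys_iff)
  then obtain Q R where
    eq: "\<And>u. u \<in> ?K \<Longrightarrow> ?m u = linear_factor i a * Q u + R u"
    and Q: "\<And>u. u \<in> ?K \<Longrightarrow> fits_under (unit_exp i) (Q u) (?m u)"
    and R: "\<And>u. u \<in> ?K \<Longrightarrow> fits_under (\<lambda>_. 0) (R u) (?m u)"
    and Ri: "\<And>u. u \<in> ?K \<Longrightarrow> \<forall>w\<in>Poly_Mapping.keys (R u). Poly_Mapping.lookup w i = 0"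
    by metis
  have "f = (\<Sum>u\<in>?K. ?m u)"
    by (rule poly_mapping_eqI) (auto simp: lookup_sum lookup_single when_def in_keys_iff)
  also have "\<dots> = linear_factor i a * (\<Sum>u\<in>?K. Q u) + (\<Sum>u\<in>?K. R u)"
    by (simp add: eq sum.distrib sum_distrib_left)
  finally have "f = linear_factor i a * (\<Sum>u\<in>?K. Q u) + (\<Sum>u\<in>?K. R u)" .
  moreover have fits: "fits_under v (\<Sum>u\<in>?K. F u) f"
    if F: "\<And>u. u \<in> ?K \<Longrightarrow> fits_under v (F u) (?m u)" for v and F :: "_ \<Rightarrow> ('n, 'a) mpol"
    unfolding fits_under_def
  proof
    fix w assume "w \<in> Poly_Mapping.keys (\<Sum>u\<in>?K. F u)"
    from subsetD[OF keys_sum_subset this] obtain u where u: "u \<in> ?K" "w \<in> Poly_Mapping.keys (F u)"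
      by blast
    from F[OF u(1)] u(2) have "\<forall>j. Poly_Mapping.lookup w j + v j \<le> Poly_Mapping.lookup u j"
      by (auto simp: fits_under_def split: if_splits)
    with u(1) show "\<exists>u\<in>?K. \<forall>j. Poly_Mapping.lookup w j + v j \<le> Poly_Mapping.lookup u j" by blast
  qed
  moreover have "Poly_Mapping.lookup w i = 0" if "w \<in> Poly_Mapping.keys (\<Sum>u\<in>?K. R u)" for w
    using subsetD[OF keys_sum_subset that] Ri by blast
  ultimately show thesis using that Q R by blast
qed

text \<open>
  Further division of the quotient \<open>q\<close> by \<open>x\<^sub>i - a\<close> adds \<open>g c\<close> to the remainder, where \<open>g\<close> is
  the divisor so far and \<open>c\<close> is free of \<open>x\<^sub>i\<close>.  This term stays under \<open>f\<close> although multiplying by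
  \<open>g\<close> raises exponents: \<open>g\<close> involves only \<open>x\<^sub>i\<close>, and \<open>q\<close> lies under \<open>f\<close> with room for \<open>deg g\<close>
  more factors \<open>x\<^sub>i\<close>.
\<close>

lemma split_division:
  fixes f :: "('n::finite, 'a::field) mpol" and M :: "'a multiset"
  shows "\<exists>q r. f = (\<Prod>a\<in>#M. linear_factor i a) * q + r \<and>
    fits_under ((\<lambda>_. 0)(i := size M)) q f \<and> fits_under (\<lambda>_. 0) r f \<and>
    (\<forall>w\<in>Poly_Mapping.keys r. Poly_Mapping.lookup w i < size M)"
proof (induction M)
  case empty
  show ?case by (intro exI[of _ f] exI[of _ 0]) (simp add: fun_upd_idem)
next
  case (add a M)
  let ?g = "\<Prod>a\<in>#M. linear_factor i a"
  from add obtain q r where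
    f: "f = ?g * q + r" and q: "fits_under ((\<lambda>_. 0)(i := size M)) q f"
    and r: "fits_under (\<lambda>_. 0) r f"
    and ri: "\<And>w. w \<in> Poly_Mapping.keys r \<Longrightarrow> Poly_Mapping.lookup w i < size M" by blast
  obtain q' c where q': "q = linear_factor i a * q' + c" "fits_under (unit_exp i) q' q"
    and c: "fits_under (\<lambda>_. 0) c q" "\<And>w. w \<in> Poly_Mapping.keys c \<Longrightarrow> Poly_Mapping.lookup w i = 0"
    using linear_division[of q i a] by blast
  have eq: "f = (\<Prod>a\<in>#add_mset a M. linear_factor i a) * q' + (?g * c + r)"
    by (simp add: f q'(1) algebra_simps)
  have key: "\<exists>x\<in>Poly_Mapping.keys c. \<forall>j. Poly_Mapping.lookup w j \<le>
      Poly_Mapping.lookup x j + (if j = i then size M else 0)"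
    if "w \<in> Poly_Mapping.keys (?g * c)" for w
  proof -
    from subsetD[OF keys_mult that] obtain x y where w: "w = x + y"
      and x: "x \<in> Poly_Mapping.keys ?g" and y: "y \<in> Poly_Mapping.keys c" by blast
    have "Poly_Mapping.lookup w j \<le> Poly_Mapping.lookup y j + (if j = i then size M else 0)" for j
      using keys_linear_factor_prod[OF x, of j] by (simp add: w lookup_add)
    with y show ?thesis by blast
  qed
  have gc: "fits_under (\<lambda>_. 0) (?g * c) f"
    unfolding fits_under_def
  proof
    fix w assume "w \<in> Poly_Mapping.keys (?g * c)"
    with key obtain x where x: "x \<in> Poly_Mapping.keys c" "\<And>j. Poly_Mapping.lookup w j \<le>
      Poly_Mapping.lookup x j + (if j = i then size M else 0)" by blast
    have "fits_under ((\<lambda>_. 0)(i := size M)) c f" using fits_under_trans[OF c(1) q] by (simp add: fun_upd_def)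
    from this x(1) obtain u where u: "u \<in> Poly_Mapping.keys f"
      "\<And>j. Poly_Mapping.lookup x j + ((\<lambda>_. 0)(i := size M)) j \<le> Poly_Mapping.lookup u j"
      by (rule fits_underE) blast
    have "Poly_Mapping.lookup w j + 0 \<le> Poly_Mapping.lookup u j" for j
      using x(2)[of j] u(2)[of j] by (auto split: if_splits)
    with u(1) show "\<exists>u\<in>Poly_Mapping.keys f.
      \<forall>j. Poly_Mapping.lookup w j + 0 \<le> Poly_Mapping.lookup u j" by blast
  qed
  have "Poly_Mapping.lookup w i < size (add_mset a M)" if "w \<in> Poly_Mapping.keys (?g * c + r)" for w
  proof -
    from subsetD[OF Poly_Mapping.keys_add that]
    consider "w \<in> Poly_Mapping.keys (?g * c)" | "w \<in> Poly_Mapping.keys r" by blast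
    then show ?thesis
    proof cases
      case 1
      then obtain x where x: "x \<in> Poly_Mapping.keys c" "\<And>j. Poly_Mapping.lookup w j \<le>
        Poly_Mapping.lookup x j + (if j = i then size M else 0)" using key by blast
      from x(2)[of i] c(2)[OF x(1)] show ?thesis by simp
    next
      case 2
      from ri[OF this] show ?thesis by simp
    qed
  qed
  moreover have "fits_under ((\<lambda>_. 0)(i := size (add_mset a M))) q' f"
    by (rule fits_under_mono[OF fits_under_trans[OF q'(2) q]]) simp
  ultimately show ?case using eq fits_under_add[OF gc r] by blast
qed

text \<open>
  Dividing by the variables one after another is harmless: a later division only shrinks exponents,
  so it preserves the degree bounds reached in the earlier variables.
\<close>

lemma grid_division:
  fixes f :: "('n::finite, 'a::field) mpol" and S :: "'n \<Rightarrow> 'a multiset"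
  assumes "finite A"
  shows "\<exists>h r. f = r + (\<Sum>i\<in>A. h i * (\<Prod>a\<in>#S i. linear_factor i a)) \<and>
    (\<forall>i. fits_under ((\<lambda>_. 0)(i := size (S i))) (h i) f) \<and> fits_under (\<lambda>_. 0) r f \<and>
    (\<forall>i\<in>A. \<forall>w\<in>Poly_Mapping.keys r. Poly_Mapping.lookup w i < size (S i))"
  using assms
proof (induction A)
  case empty
  show ?case by (intro exI[of _ "\<lambda>_. 0"] exI[of _ f]) simp
next
  case (insert i A)
  let ?g = "\<lambda>i. \<Prod>a\<in>#S i. linear_factor i a"
  from insert.IH obtain h r where f: "f = r + (\<Sum>i\<in>A. h i * ?g i)"
    and h: "\<And>i. fits_under ((\<lambda>_. 0)(i := size (S i))) (h i) f" and r: "fits_under (\<lambda>_. 0) r f"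
    and rA: "\<And>i w. i \<in> A \<Longrightarrow> w \<in> Poly_Mapping.keys r \<Longrightarrow> Poly_Mapping.lookup w i < size (S i)"
    by blast
  from split_division[of r i "S i"] obtain q r' where r': "r = ?g i * q + r'"
    "fits_under ((\<lambda>_. 0)(i := size (S i))) q r" "fits_under (\<lambda>_. 0) r' r"
    "\<And>w. w \<in> Poly_Mapping.keys r' \<Longrightarrow> Poly_Mapping.lookup w i < size (S i)" by blast
  have "(\<Sum>j\<in>insert i A. (h(i := q)) j * ?g j) = q * ?g i + (\<Sum>j\<in>A. h j * ?g j)"
    using insert.hyps by (simp cong: sum.cong) (rule sum.cong, auto)
  then have "f = r' + (\<Sum>j\<in>insert i A. (h(i := q)) j * ?g j)"
    by (subst f, subst r'(1)) (simp add: algebra_simps)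
  moreover have "fits_under ((\<lambda>_. 0)(j := size (S j))) ((h(i := q)) j) f" for j
    using h[of j] fits_under_trans0[OF r'(2) r] by simp
  moreover have "fits_under (\<lambda>_. 0) r' f" by (rule fits_under_trans0[OF r'(3) r])
  moreover have "Poly_Mapping.lookup w j < size (S j)"
    if "j \<in> insert i A" "w \<in> Poly_Mapping.keys r'" for j w
  proof (cases "j = i")
    case True
    then show ?thesis using r'(4)[OF that(2)] by simp
  next
    case False
    from r'(3) that(2) obtain u where u: "u \<in> Poly_Mapping.keys r"
      "\<And>j. Poly_Mapping.lookup w j + 0 \<le> Poly_Mapping.lookup u j" by (rule fits_underE) blast
    from False that(1) rA[OF _ u(1), of j] u(2)[of j] show ?thesis by simp
  qed
  ultimately show ?case by blast
qed


section \<open>Vanishing ideals of a point with multiplicities\<close>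

lemma shifted_coeff_expansion:
  "shifted_coeff (shifted_expansion s c) u s = Poly_Mapping.lookup c u"
proof -
  have "(THE d. shifted_expansion s c = shifted_expansion s d) = c"
    by (rule the1_equality[OF shifted_expansion_unique]) simp
  then show ?thesis by (simp add: shifted_coeff_def)
qed

lemma expansion_in_mult_ideal_iff:
  "shifted_expansion s c \<in> mult_ideal s w \<longleftrightarrow>
    (\<forall>u. (\<forall>i. Poly_Mapping.lookup u i < w i) \<longrightarrow> Poly_Mapping.lookup c u = 0)"
  by (simp add: mult_ideal_def shifted_coeff_expansion)

lemma mult_ideal_add:
  assumes "p \<in> mult_ideal s w" "q \<in> mult_ideal s w"
  shows "p + q \<in> mult_ideal s w"
proof -
  obtain c d where "p = shifted_expansion s c" "q = shifted_expansion s d"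
    using shifted_expansion_surj by blast
  with assms show ?thesis
    by (simp add: expansion_in_mult_ideal_iff lookup_add flip: shifted_expansion_add)
qed

lemma mult_ideal_diff:
  assumes "p \<in> mult_ideal s w" "q \<in> mult_ideal s w"
  shows "p - q \<in> mult_ideal s w"
proof -
  obtain c d where "p = shifted_expansion s c" "q = shifted_expansion s d"
    using shifted_expansion_surj by blast
  with assms show ?thesis
    by (simp add: expansion_in_mult_ideal_iff lookup_minus flip: shifted_expansion_diff)
qed

lemma mult_ideal_0: "0 \<in> mult_ideal s w"
  using expansion_in_mult_ideal_iff[of s 0 w] by (simp add: shifted_expansion_def)

lemma mult_ideal_sum:
  "(\<And>x. x \<in> A \<Longrightarrow> F x \<in> mult_ideal s w) \<Longrightarrow> (\<Sum>x\<in>A. F x) \<in> mult_ideal s w"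
  by (induction A rule: infinite_finite_induct) (auto intro: mult_ideal_0 mult_ideal_add)

lemma mult_ideal_mono:
  assumes "p \<in> mult_ideal s w" "\<And>i. v i \<le> w i"
  shows "p \<in> mult_ideal s v"
  using assms unfolding mult_ideal_def by (blast intro: less_le_trans)

lemma shifted_monom_mult_expansion:
  "shifted_monom s v * shifted_expansion s c = shifted_expansion s (Poly_Mapping.single v 1 * c)"
proof (induction c rule: mpol_induct)
  case zero
  show ?case by (simp add: shifted_expansion_def)
next
  case (add c d)
  then show ?case by (simp add: distrib_left shifted_expansion_add)
next
  case (single u c)
  show ?case by (simp add: shifted_expansion_single mult_single shifted_monom_add mult_ac)
qed

lemma linear_factor_mult_expansion:
  "linear_factor i (s i) * shifted_expansion s c =
    shifted_expansion s (Poly_Mapping.single (Poly_Mapping.single i 1) 1 * c)"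
  by (simp only: shifted_monom_mult_expansion flip: shifted_monom_var)

lemma linear_factor_power_in_mult_ideal:
  assumes "w i \<le> k"
  shows "linear_factor i (s i) ^ k * q \<in> mult_ideal s w"
proof -
  obtain c where q: "q = shifted_expansion s c" using shifted_expansion_surj by blast
  have "linear_factor i (s i) ^ k = shifted_monom s (Poly_Mapping.single i k)"
  proof (induction k)
    case (Suc k)
    have "Poly_Mapping.single i (Suc k) = Poly_Mapping.single i 1 + Poly_Mapping.single i k"
      by (simp flip: single_add)
    then show ?case by (simp only: shifted_monom_add shifted_monom_var Suc power_Suc)
  qed simp
  then have eq: "linear_factor i (s i) ^ k * q =
      shifted_expansion s (Poly_Mapping.single (Poly_Mapping.single i k) 1 * c)"
    by (simp add: q shifted_monom_mult_expansion)
  show ?thesis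
    unfolding eq expansion_in_mult_ideal_iff
    using assms by (auto intro!: lookup_single_mult_eq_0[of _ i] intro: less_le_trans)
qed

lemma mult_ideal_cancel_root:
  assumes "linear_factor i (s i) * q \<in> mult_ideal s w"
  shows "q \<in> mult_ideal s (w(i := w i - 1))"
proof -
  let ?e = "Poly_Mapping.single i (1::nat)"
  obtain c where q: "q = shifted_expansion s c" using shifted_expansion_surj by blast
  from assms have *: "\<forall>u. (\<forall>j. Poly_Mapping.lookup u j < w j) \<longrightarrow>
      Poly_Mapping.lookup (Poly_Mapping.single ?e 1 * c) u = 0"
    by (simp only: q linear_factor_mult_expansion expansion_in_mult_ideal_iff)
  show ?thesis
    unfolding q expansion_in_mult_ideal_iff
  proof (intro allI impI)
    fix u assume u: "\<forall>j. Poly_Mapping.lookup u j < (w(i := w i - 1)) j"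
    have "Poly_Mapping.lookup (?e + u) j < w j" for j
      using u[rule_format, of j] by (auto simp: lookup_add lookup_single when_def split: if_splits)
    from *[rule_format, OF this] show "Poly_Mapping.lookup c u = 0" by (simp add: lookup_single_mult)
  qed
qed

text \<open>
  Multiplication by \<open>x\<^sub>i - a\<close> with \<open>a \<noteq> s\<^sub>i\<close> is injective modulo the ideal.  In the expansion
  at \<open>s\<close>, the coefficient of \<open>(x\<^sub>i - a) q\<close> at \<open>u\<close> is \<open>(s\<^sub>i - a) q\<^sub>u + q\<^sub>v\<close>, where \<open>v\<close> is \<open>u\<close>
  with its entry at \<open>i\<close> lowered by one and the second term is absent if that entry is zero.  As
  \<open>s\<^sub>i - a\<close> is invertible, the coefficients \<open>q\<^sub>u\<close> with \<open>u < w\<close> vanish by induction on that entry.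
\<close>

lemma mult_ideal_cancel_unit:
  assumes "linear_factor i a * q \<in> mult_ideal s w" "a \<noteq> s i"
  shows "q \<in> mult_ideal s w"
proof -
  let ?e = "Poly_Mapping.single i (1::nat)"
  obtain c where q: "q = shifted_expansion s c" using shifted_expansion_surj by blast
  have "mconst b * shifted_expansion s c = shifted_expansion s (mconst b * c)" for b
  proof (induction c rule: mpol_induct)
    case (single u c)
    show ?case
      by (simp add: shifted_expansion_single mconst_def[of b] mult_single)
        (simp flip: mconst_def add: mconst_simps)
  qed (simp_all add: shifted_expansion_def[of _ 0] distrib_left shifted_expansion_add)
  moreover have "linear_factor i a * q = linear_factor i (s i) * q + mconst (s i - a) * q"
    by (simp add: mconst_simps algebra_simps)
  ultimately have "linear_factor i a * q =
      shifted_expansion s (Poly_Mapping.single ?e 1 * c + mconst (s i - a) * c)"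
    by (simp only: q linear_factor_mult_expansion shifted_expansion_add)
  with assms(1) have *: "\<forall>u. (\<forall>j. Poly_Mapping.lookup u j < w j) \<longrightarrow>
      Poly_Mapping.lookup (Poly_Mapping.single ?e 1 * c) u + (s i - a) * Poly_Mapping.lookup c u = 0"
    by (simp only: expansion_in_mult_ideal_iff lookup_add lookup_mconst_mult)
  have "Poly_Mapping.lookup c u = 0" if "\<And>j. Poly_Mapping.lookup u j < w j" for u
    using that
  proof (induction "Poly_Mapping.lookup u i" arbitrary: u)
    case 0
    have "Poly_Mapping.lookup (Poly_Mapping.single ?e 1 * c) u = 0"
      using 0(1) by (intro lookup_single_mult_eq_0[of _ i]) simp
    with *[rule_format, OF 0(2)] assms(2) show ?case by simp
  next
    case (Suc k)
    define v where "v = u - ?e"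
    have u: "u = ?e + v"
      using Suc.hyps(2) by (intro poly_mapping_eqI)
        (auto simp: v_def lookup_add lookup_minus lookup_single when_def)
    have "Poly_Mapping.lookup v j < w j" for j
      using Suc.prems[of j] by (simp add: u lookup_add)
    then have "Poly_Mapping.lookup c v = 0"
      using Suc.hyps by (simp add: u lookup_add)
    with *[rule_format, OF Suc.prems] assms(2) show ?case by (simp add: u lookup_single_mult)
  qed
  then show ?thesis by (simp add: q expansion_in_mult_ideal_iff)
qed


section \<open>Peeling roots off a grid\<close>

text \<open>
  The points range over an arbitrary set \<open>X\<close>, such as a slice or a punctured grid, while the orders of
  vanishing always come from \<open>S\<close>.
\<close>

definition vanishes_on :: "('n::finite \<Rightarrow> 'a::field multiset) \<Rightarrow> ('n \<Rightarrow> 'a) set \<Rightarrow> ('n, 'a) mpol \<Rightarrow> bool" where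
  "vanishes_on S X p \<longleftrightarrow> (\<forall>s\<in>X. p \<in> mult_ideal s (\<lambda>i. count (S i) (s i)))"

definition reduced :: "('n::finite \<Rightarrow> 'a::field multiset) \<Rightarrow> ('n, 'a) mpol \<Rightarrow> bool" where
  "reduced S p \<longleftrightarrow> (\<forall>w\<in>Poly_Mapping.keys p. \<forall>i. Poly_Mapping.lookup w i < size (S i))"

text \<open>
  The Hermite interpolation data on the grid determine a polynomial with partial degrees below the
  side lengths, stated for the homogeneous problem.
\<close>

definition unisolvent :: "('n::finite \<Rightarrow> 'a::field multiset) \<Rightarrow> bool" where
  "unisolvent S \<longleftrightarrow> (\<forall>p. reduced S p \<longrightarrow> vanishes_on S (mset_grid S) p \<longrightarrow> p = 0)"

text \<open>
  The remainder of a polynomial modulo \<open>x\<^sub>i - a\<close> inherits the vanishing conditions on the slice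
  \<open>x\<^sub>i = a\<close>, taken with multiplicity one in direction \<open>i\<close>, so unisolvence of this smaller grid kills
  it.
\<close>

lemma peel_root:
  fixes S :: "'n::finite \<Rightarrow> 'a::field multiset"
  assumes "a \<in># S i" "reduced S p" "unisolvent (S(i := {#a#}))"
    and van: "vanishes_on S {s \<in> mset_grid S. s i = a} p"
  obtains q where "p = linear_factor i a * q" "fits_under (unit_exp i) q p"
    "reduced (S(i := S i - {#a#})) q"
proof -
  let ?T = "S(i := {#a#})"
  obtain q r where eq: "p = linear_factor i a * q + r" and q: "fits_under (unit_exp i) q p"
    and r: "fits_under (\<lambda>_. 0) r p" "\<And>w. w \<in> Poly_Mapping.keys r \<Longrightarrow> Poly_Mapping.lookup w i = 0"
    using linear_division[of p i a] by blast
  have "reduced ?T r"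
    unfolding reduced_def
  proof (intro ballI allI)
    fix w j assume w: "w \<in> Poly_Mapping.keys r"
    with r(1) obtain u where "u \<in> Poly_Mapping.keys p"
      "\<And>j. Poly_Mapping.lookup w j + 0 \<le> Poly_Mapping.lookup u j" by (rule fits_underE) blast
    with assms(2) r(2)[OF w] show "Poly_Mapping.lookup w j < size (?T j)"
      unfolding reduced_def by (auto intro: le_less_trans)
  qed
  moreover have "vanishes_on ?T (mset_grid ?T) r"
    unfolding vanishes_on_def
  proof
    fix s assume s: "s \<in> mset_grid ?T"
    have mem: "s j \<in># ?T j" for j using s by (auto simp: mset_grid_def Pi_iff)
    have si: "s i = a" using mem[of i] by simp
    have "s \<in> mset_grid S"
      using mem assms(1) si by (fastforce simp: mset_grid_def Pi_iff split: if_splits)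
    with van si have "p \<in> mult_ideal s (\<lambda>j. count (S j) (s j))"
      by (auto simp: vanishes_on_def)
    then have "p \<in> mult_ideal s (\<lambda>j. count (?T j) (s j))"
      by (rule mult_ideal_mono) (use assms(1) si in \<open>auto simp: Suc_le_eq\<close>)
    moreover have "linear_factor i a * q \<in> mult_ideal s (\<lambda>j. count (?T j) (s j))"
      using linear_factor_power_in_mult_ideal[of "\<lambda>j. count (?T j) (s j)" i 1 s q] si by simp
    ultimately have "p - linear_factor i a * q \<in> mult_ideal s (\<lambda>j. count (?T j) (s j))"
      by (rule mult_ideal_diff)
    then show "r \<in> mult_ideal s (\<lambda>j. count (?T j) (s j))" by (simp add: eq)
  qed
  ultimately have "r = 0" using assms(3) by (simp add: unisolvent_def)
  moreover have "reduced (S(i := S i - {#a#})) q"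
    unfolding reduced_def
  proof (intro ballI allI)
    fix w j assume "w \<in> Poly_Mapping.keys q"
    with q obtain u where u: "u \<in> Poly_Mapping.keys p"
      "\<And>j. Poly_Mapping.lookup w j + unit_exp i j \<le> Poly_Mapping.lookup u j" by (rule fits_underE) blast
    from assms(2) u(1) have "Poly_Mapping.lookup u j < size (S j)" by (auto simp: reduced_def)
    with u(2)[of j] assms(1) show "Poly_Mapping.lookup w j < size ((S(i := S i - {#a#})) j)"
      by (auto simp: size_Diff_singleton split: if_splits)
  qed
  ultimately show thesis using that eq q by simp
qed

lemma mset_grid_diff_subset: "mset_grid (S(i := S i - M)) \<subseteq> mset_grid S"
proof
  fix s assume "s \<in> mset_grid (S(i := S i - M))"
  then have *: "s j \<in># (S(i := S i - M)) j" for j by (auto simp: mset_grid_def Pi_iff)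
  have "s j \<in># S j" for j using *[of j] by (auto split: if_splits dest: in_diffD)
  then show "s \<in> mset_grid S" by (simp add: mset_grid_def)
qed

lemma vanishes_on_quotient:
  fixes S :: "'n::finite \<Rightarrow> 'a::field multiset"
  assumes "vanishes_on S X (linear_factor i a * q)"
  shows "vanishes_on (S(i := S i - {#a#})) X q"
  unfolding vanishes_on_def
proof
  fix s assume "s \<in> X"
  with assms have I: "linear_factor i a * q \<in> mult_ideal s (\<lambda>j. count (S j) (s j))"
    by (simp add: vanishes_on_def)
  let ?w = "\<lambda>j. count ((S(i := S i - {#a#})) j) (s j)"
  show "q \<in> mult_ideal s ?w"
  proof (cases "s i = a")
    case True
    then have "?w = (\<lambda>j. count (S j) (s j))(i := count (S i) (s i) - 1)" by auto
    with mult_ideal_cancel_root[OF I[folded True]] show ?thesis by (simp only:)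
  next
    case False
    then have "?w = (\<lambda>j. count (S j) (s j))" by auto
    with mult_ideal_cancel_unit[OF I] False show ?thesis by auto
  qed
qed

text \<open>
  If some side has size at least two, a slice in that direction is a smaller grid, so one root can be
  peeled off, and the quotient lives on a smaller grid again.  The remaining grids have an empty
  side, where only zero is reduced, or consist of a single simple point, where a reduced polynomial
  is a constant and vanishing at the point makes it zero.
\<close>

lemma unisolvent_grid:
  fixes S :: "'n::finite \<Rightarrow> 'a::field multiset"
  shows "unisolvent S"
proof (induction "\<Sum>i\<in>UNIV. size (S i)" arbitrary: S rule: less_induct)
  case less
  have smaller: "unisolvent (S(i := M))" if "size M < size (S i)" for i M
  proof (rule less)
    show "(\<Sum>j\<in>UNIV. size ((S(i := M)) j)) < (\<Sum>j\<in>UNIV. size (S j))"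
      using that by (intro sum_strict_mono_ex1) auto
  qed
  show ?case
    unfolding unisolvent_def
  proof (intro allI impI)
    fix p assume red: "reduced S p" and van: "vanishes_on S (mset_grid S) p"
    consider i where "S i = {#}" | i where "size (S i) \<ge> 2" | "\<And>i. size (S i) = 1"
    proof -
      have "size (S i) = 0 \<or> size (S i) = 1 \<or> size (S i) \<ge> 2" for i by linarith
      then show thesis using that by (metis size_eq_0_iff_empty)
    qed
    then show "p = 0"
    proof cases
      case (1 i)
      then have "size (S i) = 0" by simp
      with red have "Poly_Mapping.keys p = {}" unfolding reduced_def by (metis all_not_in_conv not_less0)
      then show ?thesis by simp
    next
      case (2 i)
      then obtain a where a: "a \<in># S i" by fastforce
      have "unisolvent (S(i := {#a#}))" using 2 by (intro smaller) simp
      moreover have "vanishes_on S {s \<in> mset_grid S. s i = a} p"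
        using van by (auto simp: vanishes_on_def)
      ultimately obtain q where q: "p = linear_factor i a * q" "reduced (S(i := S i - {#a#})) q"
        using peel_root[OF a red] by blast
      have "vanishes_on (S(i := S i - {#a#})) (mset_grid S) q"
        using van by (intro vanishes_on_quotient) (simp add: q(1))
      then have "vanishes_on (S(i := S i - {#a#})) (mset_grid (S(i := S i - {#a#}))) q"
        using mset_grid_diff_subset[of S i "{#a#}"] unfolding vanishes_on_def by blast
      moreover have "unisolvent (S(i := S i - {#a#}))"
        using 2 a by (intro smaller) (simp add: size_Diff_singleton)
      ultimately have "q = 0" using q(2) by (simp add: unisolvent_def)
      then show ?thesis by (simp add: q(1))
    next
      case 3
      define s where "s = (\<lambda>i. SOME a. a \<in># S i)"
      have s: "s i \<in># S i" for i
        unfolding s_def by (rule someI_ex) (use 3[of i] in \<open>fastforce dest!: size_1_singleton_mset\<close>)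
      have "w = 0" if "w \<in> Poly_Mapping.keys p" for w
        using red that 3 by (intro poly_mapping_eqI) (auto simp: reduced_def)
      then have "p = mconst (Poly_Mapping.lookup p 0)"
        by (intro poly_mapping_eqI) (auto simp: mconst_def lookup_single when_def in_keys_iff)
      then have p: "p = shifted_expansion s (Poly_Mapping.single 0 (Poly_Mapping.lookup p 0))"
        by (simp add: shifted_expansion_single)
      have "s \<in> mset_grid S" using s by (simp add: mset_grid_def)
      with van have "p \<in> mult_ideal s (\<lambda>i. count (S i) (s i))" by (simp add: vanishes_on_def)
      then have "\<forall>u. (\<forall>i. Poly_Mapping.lookup u i < count (S i) (s i)) \<longrightarrow>
          Poly_Mapping.lookup (Poly_Mapping.single 0 (Poly_Mapping.lookup p 0)) u = 0"
        by (subst (asm) p) (simp only: expansion_in_mult_ideal_iff)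
      from this[rule_format, of 0] s have "Poly_Mapping.lookup p 0 = 0" by simp
      then show ?thesis using p by (simp add: shifted_expansion_def)
    qed
  qed
qed

text \<open>
  A root \<open>a\<close> of \<open>S\<^sub>i - D\<^sub>i\<close> does not occur in \<open>D\<^sub>i\<close> at all, by tightness, so the whole slice \<open>x\<^sub>i = a\<close>
  avoids \<open>D\<close> and \<open>x\<^sub>i - a\<close> can be peeled off; tightness then persists.  Keeping track of the
  exponents of the cofactor \<open>h\<close> gives the degree bound later.
\<close>

lemma punctured_grid_divisibility:
  fixes S D :: "'n::finite \<Rightarrow> 'a::field multiset"
  assumes "\<And>i. tight_submultiset (D i) (S i)" "reduced S p"
    "vanishes_on S (mset_grid S - mset_grid D) p"
  shows "\<exists>h. p = h * (\<Prod>i\<in>UNIV. \<Prod>a\<in>#S i - D i. linear_factor i a) \<and>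
    fits_under (\<lambda>i. size (S i - D i)) h p"
  using assms
proof (induction "\<Sum>i\<in>UNIV. size (S i - D i)" arbitrary: S p rule: less_induct)
  case less
  show ?case
  proof (cases "\<forall>i. S i - D i = {#}")
    case True
    then show ?thesis by (intro exI[of _ p]) simp
  next
    case False
    then obtain i a where a: "a \<in># S i - D i" by (metis multiset_nonemptyE)
    then have aS: "a \<in># S i" by (rule in_diffD)
    have aD: "a \<notin># D i"
      using a less.prems(1)[of i] by (auto simp: tight_submultiset_def in_diff_count)
    let ?S = "S(i := S i - {#a#})"
    have "vanishes_on S {s \<in> mset_grid S. s i = a} p"
      using less.prems(3) aD unfolding vanishes_on_def mset_grid_def Pi_iff by blast
    with peel_root[OF aS less.prems(2) unisolvent_grid] obtain q where
      q: "p = linear_factor i a * q" "fits_under (unit_exp i) q p" "reduced ?S q" by blast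
    have diff: "?S j - D j = (if j = i then S i - D i - {#a#} else S j - D j)" for j
      by (simp add: diff_diff_add_mset add.commute)
    have "tight_submultiset (D j) (?S j)" for j
    proof -
      have "count (S i - {#a#}) s = count (S i) s" if "s \<in># D i" for s
        using that aD by (cases "s = a") auto
      moreover from this have "set_mset (D i) \<subseteq> set_mset (S i - {#a#})"
        using less.prems(1)[of i] by (auto simp: tight_submultiset_def simp flip: count_greater_zero_iff)
      ultimately show ?thesis
        using less.prems(1)[of j] by (auto simp: tight_submultiset_def)
    qed
    moreover have "vanishes_on ?S (mset_grid ?S - mset_grid D) q"
      using vanishes_on_quotient[of S "mset_grid S - mset_grid D" i a q] less.prems(3)
        mset_grid_diff_subset[of S i "{#a#}"]
      unfolding q(1) vanishes_on_def by blast
    moreover have "(\<Sum>j\<in>UNIV. size (?S j - D j)) < (\<Sum>j\<in>UNIV. size (S j - D j))"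
    proof (rule sum_strict_mono_ex1)
      show "\<exists>j\<in>UNIV. size (?S j - D j) < size (S j - D j)"
        using a by (intro bexI[of _ i]) (simp_all only: diff size_Diff1_less UNIV_I if_True refl)
      show "\<forall>j\<in>UNIV. size (?S j - D j) \<le> size (S j - D j)"
      proof
        show "size (?S j - D j) \<le> size (S j - D j)" for j
          unfolding diff
          by (cases "j = i") (simp_all only: if_True if_False refl size_Diff1_le order_refl)
      qed
    qed simp
    ultimately obtain h where h: "q = h * (\<Prod>j\<in>UNIV. \<Prod>b\<in>#?S j - D j. linear_factor j b)"
      "fits_under (\<lambda>j. size (?S j - D j)) h q"
      using less.hyps[of ?S q] q(3) by blast
    have "(\<Prod>j\<in>UNIV. \<Prod>b\<in>#S j - D j. linear_factor j b) =
        (\<Prod>b\<in>#S i - D i. linear_factor i b) * (\<Prod>j\<in>UNIV - {i}. \<Prod>b\<in>#S j - D j. linear_factor j b)"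
      by (rule prod.remove) auto
    also have "(\<Prod>b\<in>#S i - D i. linear_factor i b) =
        (\<Prod>b\<in>#add_mset a (S i - D i - {#a#}). linear_factor i b)"
      by (simp only: insert_DiffM[OF a])
    also have "\<dots> = linear_factor i a * (\<Prod>b\<in>#?S i - D i. linear_factor i b)"
      by (simp only: diff if_True refl image_mset_add_mset prod_mset.add_mset)
    also have "(\<Prod>j\<in>UNIV - {i}. \<Prod>b\<in>#S j - D j. linear_factor j b) =
        (\<Prod>j\<in>UNIV - {i}. \<Prod>b\<in>#?S j - D j. linear_factor j b)"
      by (rule prod.cong) auto
    also have "linear_factor i a * (\<Prod>b\<in>#?S i - D i. linear_factor i b) * \<dots> =
        linear_factor i a * (\<Prod>j\<in>UNIV. \<Prod>b\<in>#?S j - D j. linear_factor j b)"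
      by (subst (2) prod.remove[of _ i]) (simp_all add: mult.assoc)
    finally have "p = h * (\<Prod>j\<in>UNIV. \<Prod>b\<in>#S j - D j. linear_factor j b)"
      by (simp only: q(1) h(1) mult_ac)
    moreover have "fits_under (\<lambda>j. size (S j - D j)) h p"
    proof (rule fits_under_mono[OF fits_under_trans[OF h(2) q(2)]])
      show "size (S j - D j) \<le> size (?S j - D j) + unit_exp i j" for j
      proof (cases "j = i")
        case True
        have "size (?S i - D i) = size (S i - D i) - 1"
          by (simp only: diff if_True refl size_Diff_singleton[OF a])
        then show ?thesis unfolding True by (simp del: diff_diff_add_mset)
      qed simp
    qed
    ultimately show ?thesis by blast
  qed
qed


section \<open>Univariate factors and degrees\<close>

lemma at_var_pCons: "at_var i (pCons a p) = mconst a + mvar i * at_var i p"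
  by (simp add: at_var_def map_poly_pCons mconst_simps)

lemma at_var_mult_linear:
  fixes p :: "'a::field poly"
  shows "at_var i ([:- a, 1:] * p) = linear_factor i a * at_var i p"
proof -
  have smult: "at_var i (smult b p) = mconst b * at_var i p" for b and p :: "'a poly"
    by (simp add: at_var_def map_poly_smult mconst_simps)
  have "at_var i (p + q) = at_var i p + at_var i q" for p q :: "'a poly"
  proof (induction p q rule: poly_induct2)
    case 0
    show ?case by (simp add: at_var_def)
  next
    case (pCons a p b q)
    then show ?case by (simp add: at_var_pCons mconst_simps algebra_simps)
  qed
  moreover have "[:- a, 1:] * p = smult (- a) p + pCons 0 p"
    by (simp add: algebra_simps)
  ultimately have "at_var i ([:- a, 1:] * p) = mconst (- a) * at_var i p + mvar i * at_var i p"
    by (simp only: smult at_var_pCons mconst_simps) simp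
  also have "mconst (- a) = - mconst a" using mconst_simps(4)[of 0 a] by (simp add: mconst_simps)
  finally show ?thesis by (simp add: algebra_simps)
qed

lemma mset_poly_eq: "mset_poly M = (\<Prod>a\<in>#M. [:- a, 1:])"
  by (simp add: mset_poly_def image_prod_mset_multiplicity)

lemma at_var_mset_poly: "at_var i (mset_poly M) = (\<Prod>a\<in>#M. linear_factor i a)"
proof (induction M)
  case empty
  show ?case by (simp add: mset_poly_eq at_var_def mconst_simps)
next
  case (add a M)
  have "mset_poly (add_mset a M) = [:- a, 1:] * mset_poly M" by (simp add: mset_poly_eq)
  with add at_var_mult_linear[of i a "mset_poly M"] show ?case by simp
qed

lemma tight_imp_subset: "tight_submultiset D S \<Longrightarrow> D \<subseteq># S"
  unfolding tight_submultiset_def subseteq_mset_def by (metis count_eq_zero_iff le_refl zero_le)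

lemma mset_poly_div:
  assumes "D \<subseteq># S"
  shows "mset_poly S div mset_poly D = mset_poly (S - D)"
proof -
  have "mset_poly S = mset_poly (S - D + D)" using assms by (simp only: subset_mset.diff_add)
  also have "\<dots> = mset_poly (S - D) * mset_poly D" by (simp add: mset_poly_eq)
  finally show ?thesis by (simp add: mset_poly_def)
qed

lemma linear_factor_prod_in_mult_ideal:
  "q * (\<Prod>a\<in>#S i. linear_factor i a) \<in> mult_ideal s (\<lambda>j. count (S j) (s j))"
proof (cases "s i \<in># S i")
  case True
  then have "(\<Prod>a\<in>#S i. linear_factor i a) = linear_factor i (s i) ^ count (S i) (s i) *
      (\<Prod>a\<in>set_mset (S i) - {s i}. linear_factor i a ^ count (S i) a)"
    by (simp add: image_prod_mset_multiplicity prod.remove)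
  then have "q * (\<Prod>a\<in>#S i. linear_factor i a) = linear_factor i (s i) ^ count (S i) (s i) *
      (q * (\<Prod>a\<in>set_mset (S i) - {s i}. linear_factor i a ^ count (S i) a))"
    by (simp only: mult_ac)
  then show ?thesis
    by (simp only: linear_factor_power_in_mult_ideal[where w = "\<lambda>j. count (S j) (s j)"] order_refl)
next
  case False
  \<comment> \<open>A multiplicity zero makes the ideal the whole ring.\<close>
  then have "count (S i) (s i) = 0" by (simp add: count_eq_zero_iff)
  then show ?thesis
    using linear_factor_power_in_mult_ideal[of "\<lambda>j. count (S j) (s j)" i 0 s] by simp
qed

lemma mtotal_degree_fits_under:
  assumes "fits_under v q f"
  shows "mtotal_degree q \<le> mtotal_degree f - ereal (real (\<Sum>i\<in>UNIV. v i))"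
  unfolding mtotal_degree_def[of q]
proof (rule SUP_least)
  fix w assume "w \<in> Poly_Mapping.keys q"
  with assms obtain u where u: "u \<in> Poly_Mapping.keys f"
    "\<And>j. Poly_Mapping.lookup w j + v j \<le> Poly_Mapping.lookup u j" by (rule fits_underE) blast
  have "(\<Sum>i\<in>UNIV. Poly_Mapping.lookup w i) + (\<Sum>i\<in>UNIV. v i) \<le> (\<Sum>i\<in>UNIV. Poly_Mapping.lookup u i)"
    using u(2) by (simp add: sum_mono flip: sum.distrib)
  then have "ereal (real (\<Sum>i\<in>UNIV. Poly_Mapping.lookup w i)) \<le>
      ereal (real (\<Sum>i\<in>UNIV. Poly_Mapping.lookup u i)) - ereal (real (\<Sum>i\<in>UNIV. v i))"
    by (simp del: of_nat_sum)
  also have "\<dots> \<le> mtotal_degree f - ereal (real (\<Sum>i\<in>UNIV. v i))"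
    unfolding mtotal_degree_def using u(1) by (intro ereal_minus_mono SUP_upper) auto
  finally show "ereal (real (\<Sum>i\<in>UNIV. Poly_Mapping.lookup w i)) \<le>
      mtotal_degree f - ereal (real (\<Sum>i\<in>UNIV. v i))" .
qed

lemma mtotal_degree_ge_0:
  assumes "f \<noteq> 0"
  shows "mtotal_degree f \<ge> 0"
proof -
  from assms obtain u where "u \<in> Poly_Mapping.keys f" using keys_eq_empty by blast
  then have "ereal (real (\<Sum>i\<in>UNIV. Poly_Mapping.lookup u i)) \<le> mtotal_degree f"
    unfolding mtotal_degree_def by (rule SUP_upper)
  moreover have "0 \<le> ereal (real (\<Sum>i\<in>UNIV. Poly_Mapping.lookup u i))"
    by (simp del: of_nat_sum)
  ultimately show ?thesis by (rule order_trans[rotated])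
qed

lemma mdegree_in_less:
  assumes "\<And>w. w \<in> Poly_Mapping.keys p \<Longrightarrow> Poly_Mapping.lookup w i < d" "d > 0"
  shows "mdegree_in i p < ereal (real d)"
proof -
  have "mdegree_in i p \<le> ereal (real (d - 1))"
    unfolding mdegree_in_def
  proof (rule SUP_least)
    fix w assume "w \<in> Poly_Mapping.keys p"
    from assms(1)[OF this] show "ereal (real (Poly_Mapping.lookup w i)) \<le> ereal (real (d - 1))"
      by simp
  qed
  also have "\<dots> < ereal (real d)" using assms(2) by simp
  finally show ?thesis .
qed


section \<open>Division on a punctured grid\<close>

theorem theorem7:
  fixes S D :: "'n::finite \<Rightarrow> 'a::field multiset"
    and f :: "('n, 'a) mpol"
  assumes "\<And>i. S i \<noteq> {#}"
    and "\<And>i. D i \<noteq> {#}"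
    and "\<And>i. tight_submultiset (D i) (S i)"
    and "\<forall>s \<in> mset_grid S - mset_grid D. f \<in> mult_ideal s (\<lambda>i. count (S i) (s i))"
    and "\<exists>s \<in> mset_grid D. f \<notin> mult_ideal s (\<lambda>i. count (S i) (s i))"
  shows "(\<exists>(h :: 'n \<Rightarrow> ('n, 'a) mpol) (r :: ('n, 'a) mpol).
            (\<forall>i. mtotal_degree (h i) \<le> mtotal_degree f - ereal (real (size (S i)))) \<and>
            (\<forall>i. mdegree_in i r < ereal (real (size (S i)))) \<and>
            f = r + (\<Sum>i\<in>UNIV. h i * at_var i (mset_poly (S i))) \<and>
            (\<exists>h0 :: ('n, 'a) mpol. h0 \<noteq> 0 \<and>
               r = h0 * (\<Prod>i\<in>UNIV. at_var i (mset_poly (S i) div mset_poly (D i))))) \<and>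
         mtotal_degree f \<ge> ereal (\<Sum>i\<in>UNIV. real (size (S i)) - real (size (D i)))"
proof -
  have sub: "D i \<subseteq># S i" for i by (rule tight_imp_subset[OF assms(3)])
  obtain h r where f: "f = r + (\<Sum>i\<in>UNIV. h i * (\<Prod>a\<in>#S i. linear_factor i a))"
    and h: "\<And>i. fits_under ((\<lambda>_. 0)(i := size (S i))) (h i) f"
    and r: "fits_under (\<lambda>_. 0) r f"
    and red: "\<And>i w. w \<in> Poly_Mapping.keys r \<Longrightarrow> Poly_Mapping.lookup w i < size (S i)"
    using grid_division[of UNIV f S] by auto
  let ?H = "\<Sum>i\<in>UNIV. h i * (\<Prod>a\<in>#S i. linear_factor i a)"
  have H: "?H \<in> mult_ideal s (\<lambda>i. count (S i) (s i))" for s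
    by (intro mult_ideal_sum linear_factor_prod_in_mult_ideal)
  have "vanishes_on S (mset_grid S - mset_grid D) r"
    unfolding vanishes_on_def
  proof
    fix s assume "s \<in> mset_grid S - mset_grid D"
    with assms(4) have "f - ?H \<in> mult_ideal s (\<lambda>i. count (S i) (s i))"
      by (blast intro: mult_ideal_diff H)
    then show "r \<in> mult_ideal s (\<lambda>i. count (S i) (s i))" by (subst (asm) f) simp
  qed
  moreover have "reduced S r" using red by (simp add: reduced_def)
  ultimately obtain h0 where h0: "r = h0 * (\<Prod>i\<in>UNIV. \<Prod>a\<in>#S i - D i. linear_factor i a)"
    "fits_under (\<lambda>i. size (S i - D i)) h0 r"
    using punctured_grid_divisibility[of D S r] assms(3) by blast
  have "r \<noteq> 0" using assms(5) f H by auto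
  then have "h0 \<noteq> 0" using h0(1) by auto
  have "mtotal_degree (h i) \<le> mtotal_degree f - ereal (real (size (S i)))" for i
    using mtotal_degree_fits_under[OF h[of i]] by simp
  moreover have "mdegree_in i r < ereal (real (size (S i)))" for i
    using red assms(1)[of i] by (intro mdegree_in_less) (auto simp: nonempty_has_size)
  moreover have "f = r + (\<Sum>i\<in>UNIV. h i * at_var i (mset_poly (S i)))"
    using f by (simp only: at_var_mset_poly)
  moreover have "r = h0 * (\<Prod>i\<in>UNIV. at_var i (mset_poly (S i) div mset_poly (D i)))"
    using h0(1) by (simp only: at_var_mset_poly mset_poly_div[OF sub])
  moreover have "mtotal_degree f \<ge> ereal (\<Sum>i\<in>UNIV. real (size (S i)) - real (size (D i)))"
  proof -
    have "0 \<le> mtotal_degree h0" by (rule mtotal_degree_ge_0[OF \<open>h0 \<noteq> 0\<close>])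
    also have "\<dots> \<le> mtotal_degree f - ereal (real (\<Sum>i\<in>UNIV. size (S i - D i)))"
      by (rule mtotal_degree_fits_under[OF fits_under_trans0[OF h0(2) r]])
    finally have "ereal (real (\<Sum>i\<in>UNIV. size (S i - D i))) \<le> mtotal_degree f"
      by (simp add: ereal_le_minus_iff del: of_nat_sum)
    moreover have "real (\<Sum>i\<in>UNIV. size (S i - D i)) =
        (\<Sum>i\<in>UNIV. real (size (S i)) - real (size (D i)))"
      by (simp add: size_Diff_submset[OF sub] size_mset_mono[OF sub] of_nat_diff)
    ultimately show ?thesis by simp
  qed
  ultimately show ?thesis using \<open>h0 \<noteq> 0\<close> by blast
qed

end
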